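(* Let $G=(V,E)$ be a connected amply regular graph with parameters $(n,d,\alpha,\beta)$. (i) If $\beta\neq 1$ and $\beta\geq\alpha$, then $\mathrm{diam}(G)\leq d$. (ii) If $\beta>\alpha\geq 1$, then $\mathrm{diam}(G)\leq\left\lfloor\frac{2}{3}d\right\rfloor$.
   Context: Graphs are finite and simple. An amply regular graph with parameters $(n,d,\alpha,\beta)$ is a $d$-regular graph on $n$ vertices such that (i) any two adjacent vertices have exactly $\alpha$ common neighbors, and (ii) any two vertices at distance $2$ have exactly $\beta$ common neighbors. $\mathrm{diam}(G)$ is the maximum over pairs of vertices of the length of a shortest path connecting them. *)

theory Defs
  imports "Graph_Theory.Graph_Theory"
begin

context wf_digraph
begin

text \<open>Giving every arc weight 1, the cost of a walk is its length and the library's \<open>\<mu>\<close> is the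
  length of a shortest walk, with value \<open>\<infinity>\<close> if there is none.\<close>

definition graph_dist :: "'a \<Rightarrow> 'a \<Rightarrow> ereal" where
  "graph_dist u v = \<mu> (\<lambda>_. 1) u v"

definition diam :: ereal where
  "diam = Max {graph_dist u v | u v. u \<in> verts G \<and> v \<in> verts G}"

definition common_neighbors :: "'a \<Rightarrow> 'a \<Rightarrow> 'a set" where
  "common_neighbors u v = {w \<in> verts G. u \<rightarrow> w \<and> v \<rightarrow> w}"

end

text \<open>The library's \<open>graph\<close> is a finite simple graph, each undirected edge being represented by
  two opposite arcs; hence the degree of a vertex is its out-degree. The parameters \<open>\<alpha>\<close> and \<open>\<beta>\<close>
  are unconstrained when there are no adjacent vertices, respectively no vertices at distance 2.\<close>

locale amply_regular_graph = graph G for G :: "('a, 'b) pre_digraph" (structure) +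
  fixes n d \<alpha> \<beta> :: nat
  assumes card_verts: "card (verts G) = n"
    and regular: "v \<in> verts G \<Longrightarrow> out_degree G v = d"
    and adjacent: "\<lbrakk>u \<in> verts G; v \<in> verts G; u \<rightarrow> v\<rbrakk>
      \<Longrightarrow> card (common_neighbors u v) = \<alpha>"
    and distance_2: "\<lbrakk>u \<in> verts G; v \<in> verts G; graph_dist u v = 2\<rbrakk>
      \<Longrightarrow> card (common_neighbors u v) = \<beta>"

end

theory Submission
  imports Defs
begin

text \<open>The shape of the argument is that of a Bonnet--Myers theorem for the Lin--Lu--Yau curvature.
  Let \<open>f\<close> be the distance from a fixed vertex and \<open>S v\<close> the sum of \<open>f w - f v\<close> over the neighbours
  \<open>w\<close> of \<open>v\<close>. It suffices that \<open>S u - S v \<ge> c\<close> whenever \<open>v\<close> is a neighbour of \<open>u\<close> with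
  \<open>f v = f u + 1\<close>, with \<open>c = 2\<close> in the first case and \<open>c = 3\<close> in the second: along a shortest path
  \<open>S\<close> starts at \<open>d\<close> and never drops below \<open>-d\<close>, so \<open>c\<close> times the length is at most \<open>2 * d\<close>.

  To bound \<open>S u - S v\<close>, sum the increments of \<open>f\<close>, each at most 1, over the arcs from
  \<open>L = N(u) - {v}\<close> to \<open>R = N(v) - {u}\<close>. A vertex of \<open>L\<close> has \<open>\<alpha> - 1\<close> neighbours in \<open>R\<close> if it lies in
  \<open>L \<inter> R\<close> and \<open>\<beta> - 1\<close> otherwise, and symmetrically. The contributions of \<open>L \<inter> R\<close> therefore cancel,
  the sum is \<open>\<beta> - 1\<close> times the difference of the sums of \<open>f\<close> over \<open>R\<close> and \<open>L\<close>, and no matching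
  between \<open>L\<close> and \<open>R\<close> has to be constructed.\<close>

unbundle no funcset_syntax

section \<open>Neighbourhoods and distances in digraphs\<close>

context wf_digraph
begin

definition neighborhood :: "'a \<Rightarrow> 'a set" where
  "neighborhood v = {w. v \<rightarrow> w}"

text \<open>The \<open>S\<close> of the overview: the unnormalised graph Laplacian, adjacency minus
  degree.\<close>

definition laplacian :: "('a \<Rightarrow> int) \<Rightarrow> 'a \<Rightarrow> int" where
  "laplacian f v = (\<Sum>w \<in> neighborhood v. f w - f v)"

lemma in_neighborhood [simp]: "w \<in> neighborhood v \<longleftrightarrow> v \<rightarrow> w"
  by (simp add: neighborhood_def)

lemma common_neighbors_eq: "common_neighbors u v = neighborhood u \<inter> neighborhood v"
  by (auto simp: common_neighbors_def dest: adj_in_verts)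

lemma awalk_cost_one: "awalk_cost (\<lambda>_. 1) p = length p"
  by (induct p) auto

lemma graph_dist_le_length: "awalk u p v \<Longrightarrow> graph_dist u v \<le> length p"
  using min_cost_le_walk_cost[of u p v "\<lambda>_. 1"] by (simp add: graph_dist_def awalk_cost_one)

lemma graph_dist_refl: "u \<in> verts G \<Longrightarrow> graph_dist u u \<le> 0"
  using graph_dist_le_length[of u "[]" u] by (simp add: awalk_Nil_iff zero_ereal_def)

end

lemma (in fin_digraph) finite_neighborhood [simp]: "finite (neighborhood v)"
  by (rule finite_subset[OF _ finite_verts]) (auto dest: adj_in_verts)

lemma (in digraph) card_neighborhood: "card (neighborhood v) = out_degree G v"
proof -
  have "neighborhood v = head G ` out_arcs G v"
    by (auto simp: arcs_ends_conv)
  moreover have "inj_on (head G) (out_arcs G v)"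
    by (rule inj_onI) (auto intro: no_multi_arcs simp: arc_to_ends_def)
  ultimately show ?thesis
    by (simp add: card_image out_degree_def)
qed

context fin_digraph
begin

lemma graph_dist_walk:
  assumes "u \<rightarrow>\<^sup>* v"
  obtains p where "awalk u p v" "graph_dist u v = length p"
  using min_cost_awalk[OF assms, of "\<lambda>_. 1"]
  by (auto simp: graph_dist_def awalk_cost_one apath_def)

lemma graph_dist_adjacent:
  assumes "u \<rightarrow> v" shows "graph_dist s v \<le> graph_dist s u + 1"
proof -
  from assms obtain e where "e \<in> arcs G" "arc_to_ends G e = (u, v)"
    by (auto simp: arcs_ends_conv arc_to_ends_def)
  then show ?thesis
    using pos_cost_mu_triangle[of "\<lambda>_. 1" e u v s]
    by (simp add: graph_dist_def one_ereal_def)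
qed

lemma graph_dist_predecessor:
  assumes "s \<rightarrow>\<^sup>* v" "v \<noteq> s"
  obtains u where "u \<rightarrow> v" "graph_dist s v = graph_dist s u + 1"
proof -
  obtain u e where "\<mu> (\<lambda>_. 1) s v = \<mu> (\<lambda>_. 1) s u + ereal 1" "arc e (u, v)"
    using mu_exact_triangle[of v s "\<lambda>_. 1"] assms by auto
  then show ?thesis
    by (intro that[of u]) (auto simp: graph_dist_def one_ereal_def arc_def arcs_ends_conv)
qed

lemma graph_dist_eq_2:
  assumes "u \<rightarrow> w" "w \<rightarrow> v" "u \<noteq> v" "\<not> u \<rightarrow> v"
  shows "graph_dist u v = 2"
proof -
  have "u \<rightarrow>\<^sup>* v"
    using assms(1,2) by (blast intro: reachable_trans)
  then obtain p where p: "awalk u p v" "graph_dist u v = length p"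
    by (rule graph_dist_walk)
  have "p \<noteq> []"
    using p assms(3) by (auto simp: awalk_Nil_iff)
  moreover have "p \<noteq> [e]" for e
    using p assms(4) by (auto simp: awalk_simps arcs_ends_conv)
  ultimately have "2 \<le> length p"
    by (metis leI length_0_conv length_Suc_conv less_2_cases)
  moreover obtain e1 where "e1 \<in> arcs G" "tail G e1 = u" "head G e1 = w"
    using assms(1) by (rule reachableE)
  moreover obtain e2 where "e2 \<in> arcs G" "tail G e2 = w" "head G e2 = v"
    using assms(2) by (rule reachableE)
  ultimately have "2 \<le> length p" "awalk u [e1, e2] v"
    by (auto simp: awalk_simps)
  then show ?thesis
    using graph_dist_le_length[of u "[e1, e2]" v] p(2) by simp
qed

end

text \<open>Double counting: each value of \<open>f\<close> enters once per \<open>P\<close>-partner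
  on the other side, so only these degrees matter and not how the partners are arranged.\<close>

lemma sum_increments_eq:
  fixes f :: "'a \<Rightarrow> int"
  assumes [simp]: "finite A" "finite B" and sym: "\<And>x y. P x y \<longleftrightarrow> P y x"
  shows "(\<Sum>x\<in>A. \<Sum>y\<in>{y \<in> B. P x y}. f y - f x) =
    (\<Sum>y\<in>B. int (card {x \<in> A. P y x}) * f y) - (\<Sum>x\<in>A. int (card {y \<in> B. P x y}) * f x)"
proof -
  have "(\<Sum>x\<in>A. \<Sum>y\<in>{y \<in> B. P x y}. f y) = (\<Sum>y\<in>B. \<Sum>x\<in>{x \<in> A. P x y}. f y)"
    by (rule sum.swap_restrict) auto
  then show ?thesis
    by (simp add: sum_subtractf sym)
qed

section \<open>The drop of the Laplacian along an edge\<close>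

context amply_regular_graph
begin

lemma adj_sym: "u \<rightarrow> v \<longleftrightarrow> v \<rightarrow> u"
  using arcs_ends_symmetric[OF sym_arcs] by metis

lemma card_neighborhood_eq: "v \<in> verts G \<Longrightarrow> card (neighborhood v) = d"
  by (simp add: card_neighborhood regular)

lemma laplacian_eq:
  assumes "v \<in> verts G"
  shows "laplacian f v = sum f (neighborhood v) - int d * f v"
  using assms by (simp add: laplacian_def sum_subtractf card_neighborhood_eq)

text \<open>The missing 1 is \<open>u\<close>, always a common neighbour of \<open>z\<close> and
  \<open>v\<close>. It also puts them at distance 2 when they are not adjacent.\<close>

lemma card_neighbors_across_edge:
  assumes "u \<rightarrow> v" "z \<in> neighborhood u - {v}"
  shows "int (card {w \<in> neighborhood v - {u}. z \<rightarrow> w}) = int (if z \<rightarrow> v then \<alpha> else \<beta>) - 1"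
proof -
  have z: "z \<in> verts G" "v \<in> verts G" "z \<rightarrow> u" "v \<rightarrow> u" "z \<noteq> v"
    using assms adj_sym by (auto dest: adj_in_verts)
  define W where "W = {w \<in> neighborhood v - {u}. z \<rightarrow> w}"
  have "graph_dist z v = 2" if "\<not> z \<rightarrow> v"
    using graph_dist_eq_2[of z u v] z assms that by blast
  then have "card (common_neighbors z v) = (if z \<rightarrow> v then \<alpha> else \<beta>)"
    using adjacent distance_2 z by simp
  moreover have "common_neighbors z v = insert u W"
    using z by (auto simp: W_def common_neighbors_eq)
  moreover have "finite W" "u \<notin> W"
    by (rule finite_subset[of _ "neighborhood v"]) (auto simp: W_def)
  ultimately have "Suc (card W) = (if z \<rightarrow> v then \<alpha> else \<beta>)"
    by simp
  then have "int (card W) = int (if z \<rightarrow> v then \<alpha> else \<beta>) - 1"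
    by linarith
  then show ?thesis
    unfolding W_def .
qed

text \<open>The left side counts the arcs lost between \<open>L\<close> and \<open>R\<close> because
  \<open>\<alpha>\<close> vertices have degree \<open>\<alpha> - 1\<close> instead of
  \<open>\<beta> - 1\<close>. The factor \<open>\<beta> - 1\<close> is kept, to be divided out once
  its sign is known.\<close>

lemma laplacian_drop_bound:
  assumes uv: "u \<rightarrow> v" "f v = f u + 1"
    and lipschitz: "\<And>x y. x \<rightarrow> y \<Longrightarrow> f y \<le> f x + 1"
  shows "(int \<beta> - int \<alpha>) * int \<alpha> \<le> (int \<beta> - 1) * (laplacian f u - laplacian f v - 2)"
proof -
  define L R where "L = neighborhood u - {v}" and "R = neighborhood v - {u}"
  define D where "D = L \<inter> R"
  have vu: "v \<rightarrow> u" and verts: "u \<in> verts G" "v \<in> verts G"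
    using uv adj_sym by (auto dest: adj_in_verts)
  have [simp]: "finite L" "finite R" "finite D"
    by (auto simp: L_def R_def D_def)
  have LR: "neighborhood u = insert v L" "neighborhood v = insert u R" "v \<notin> L" "u \<notin> R"
    using uv vu by (auto simp: L_def R_def)
  have "D = common_neighbors u v"
    using adj_not_same by (auto simp: D_def L_def R_def common_neighbors_eq)
  then have card_D: "card D = \<alpha>"
    using adjacent verts uv by simp
  have card_L: "int (card L) = int d - 1" and sum_L: "sum f (neighborhood u) = f v + sum f L"
    and sum_R: "sum f (neighborhood v) = f u + sum f R"
    using card_neighborhood_eq[OF verts(1)] LR by auto
  \<comment> \<open>Written as a constant degree with a deficit on \<open>D\<close>, the form that
    \<open>weighted\<close> evaluates.\<close>
  have deg_L: "int (card {w \<in> R. z \<rightarrow> w}) = (int \<beta> - 1) - (if z \<in> D then int \<beta> - int \<alpha> else 0)"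
    if "z \<in> L" for z
  proof -
    have "z \<in> D \<longleftrightarrow> z \<rightarrow> v"
      using that adj_sym adj_not_same by (auto simp: D_def L_def R_def)
    then show ?thesis
      using card_neighbors_across_edge[OF uv(1), of z] that by (simp add: L_def R_def)
  qed
  have deg_R: "int (card {w \<in> L. z \<rightarrow> w}) = (int \<beta> - 1) - (if z \<in> D then int \<beta> - int \<alpha> else 0)"
    if "z \<in> R" for z
  proof -
    have "z \<in> D \<longleftrightarrow> z \<rightarrow> u"
      using that adj_sym adj_not_same by (auto simp: D_def L_def R_def)
    then show ?thesis
      using card_neighbors_across_edge[OF vu, of z] that by (simp add: L_def R_def)
  qed
  have weighted: "(\<Sum>z\<in>A. ((int \<beta> - 1) - (if z \<in> D then int \<beta> - int \<alpha> else 0)) * g z)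
      = (int \<beta> - 1) * sum g A - (int \<beta> - int \<alpha>) * sum g D"
    if "D \<subseteq> A" "finite A" for A and g :: "'a \<Rightarrow> int"
  proof -
    have "(\<Sum>z\<in>A. (if z \<in> D then int \<beta> - int \<alpha> else 0) * g z)
        = (\<Sum>z\<in>D. (int \<beta> - int \<alpha>) * g z)"
      using that by (intro sum.mono_neutral_cong_right) auto
    then show ?thesis
      by (simp add: left_diff_distrib sum_subtractf sum_distrib_left)
  qed
  have D_sub: "D \<subseteq> L" "D \<subseteq> R"
    by (auto simp: D_def)
  have "(\<Sum>z\<in>L. \<Sum>w\<in>{w \<in> R. z \<rightarrow> w}. f w - f z)
      = (\<Sum>w\<in>R. int (card {z \<in> L. w \<rightarrow> z}) * f w) - (\<Sum>z\<in>L. int (card {w \<in> R. z \<rightarrow> w}) * f z)"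
    using adj_sym by (intro sum_increments_eq) auto
  \<comment> \<open>Both sums carry the same deficit term in \<open>sum f D\<close>, which
    cancels.\<close>
  also have "\<dots> = (int \<beta> - 1) * (sum f R - sum f L)"
    by (simp add: deg_L deg_R weighted[OF D_sub(1)] weighted[OF D_sub(2)] right_diff_distrib)
  finally have increments: "(int \<beta> - 1) * (sum f R - sum f L)
      = (\<Sum>z\<in>L. \<Sum>w\<in>{w \<in> R. z \<rightarrow> w}. f w - f z)" ..
  also have "\<dots> \<le> (\<Sum>z\<in>L. \<Sum>w\<in>{w \<in> R. z \<rightarrow> w}. 1)"
    by (intro sum_mono) (auto dest!: lipschitz)
  also have "\<dots> = (int \<beta> - 1) * (int d - 1) - (int \<beta> - int \<alpha>) * int \<alpha>"
    using weighted[OF D_sub(1), of "\<lambda>_. 1"] by (simp add: deg_L card_L card_D)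
  finally have *: "(int \<beta> - 1) * (sum f R - sum f L)
      \<le> (int \<beta> - 1) * (int d - 1) - (int \<beta> - int \<alpha>) * int \<alpha>" .
  \<comment> \<open>The term of the edge itself gives 1, and the shift of base value from
    \<open>f u\<close> to \<open>f v\<close> gives \<open>d\<close>.\<close>
  have drop: "laplacian f u - laplacian f v - 2 = int d - 1 - (sum f R - sum f L)"
    using uv(2) by (simp add: laplacian_eq verts sum_L sum_R algebra_simps)
  then show ?thesis
    unfolding drop using * by (simp add: right_diff_distrib)
qed

text \<open>For \<open>\<beta>\<close> at least 2 the factor \<open>\<beta> - 1\<close> is positive
  and cancels; for \<open>\<beta> = 0\<close> it is negative, hence the separate case.\<close>

lemma laplacian_drop_ge_2:
  assumes uv: "u \<rightarrow> v" "f v = f u + 1"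
    and lipschitz: "\<And>x y. x \<rightarrow> y \<Longrightarrow> f y \<le> f x + 1"
    and "\<beta> \<noteq> 1" "\<alpha> \<le> \<beta>"
  shows "2 \<le> laplacian f u - laplacian f v"
proof (cases "\<beta> = 0")
  case True
  have vu: "v \<rightarrow> u" and verts: "u \<in> verts G" "v \<in> verts G"
    using uv adj_sym by (auto dest: adj_in_verts)
  \<comment> \<open>Here \<open>\<alpha>\<close> is 0 too, so a further neighbour would have -1
    neighbours across the edge. The edge is thus a whole component.\<close>
  have "neighborhood x - {y} = {}" if "x \<rightarrow> y" for x y
    using card_neighbors_across_edge[OF that] True \<open>\<alpha> \<le> \<beta>\<close> by (force split: if_splits)
  then have nbh: "neighborhood u = {v}" "neighborhood v = {u}"
    using uv(1) vu in_neighborhood by blast+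
  show ?thesis
    using uv(2) by (simp add: laplacian_def nbh)
next
  case False
  have "0 \<le> (int \<beta> - int \<alpha>) * int \<alpha>"
    using \<open>\<alpha> \<le> \<beta>\<close> by simp
  also have "\<dots> \<le> (int \<beta> - 1) * (laplacian f u - laplacian f v - 2)"
    using uv lipschitz by (rule laplacian_drop_bound)
  finally have "(int \<beta> - 1) * 0 \<le> (int \<beta> - 1) * (laplacian f u - laplacian f v - 2)"
    by (simp only: mult_zero_right)
  moreover have "0 < int \<beta> - 1"
    using False \<open>\<beta> \<noteq> 1\<close> by simp
  ultimately have "0 \<le> laplacian f u - laplacian f v - 2"
    by (rule mult_left_le_imp_le)
  then show ?thesis
    by simp
qed

text \<open>Now the left side of the bound is positive, so the drop exceeds 2 and, being an integer,
  is at least 3.\<close>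

lemma laplacian_drop_ge_3:
  assumes uv: "u \<rightarrow> v" "f v = f u + 1"
    and lipschitz: "\<And>x y. x \<rightarrow> y \<Longrightarrow> f y \<le> f x + 1"
    and "\<alpha> < \<beta>" "1 \<le> \<alpha>"
  shows "3 \<le> laplacian f u - laplacian f v"
proof -
  have "0 < (int \<beta> - int \<alpha>) * int \<alpha>"
    using \<open>\<alpha> < \<beta>\<close> \<open>1 \<le> \<alpha>\<close> by (intro mult_pos_pos) simp_all
  also have "\<dots> \<le> (int \<beta> - 1) * (laplacian f u - laplacian f v - 2)"
    using uv lipschitz by (rule laplacian_drop_bound)
  finally have "0 < laplacian f u - laplacian f v - 2"
    by (rule zero_less_mult_pos) (use \<open>\<alpha> < \<beta>\<close> \<open>1 \<le> \<alpha>\<close> in linarith)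
  then show ?thesis
    by simp
qed

section \<open>From drops along edges to the diameter\<close>

lemma laplacian_bounds:
  assumes "v \<in> verts G" and lipschitz: "\<And>x y. x \<rightarrow> y \<Longrightarrow> f y \<le> f x + 1"
  shows "laplacian f v \<le> int d" "- int d \<le> laplacian f v"
proof -
  have "laplacian f v \<le> (\<Sum>w \<in> neighborhood v. 1)"
    unfolding laplacian_def by (intro sum_mono) (auto dest!: lipschitz)
  then show "laplacian f v \<le> int d"
    using assms(1) by (simp add: card_neighborhood_eq)
  have "(\<Sum>w \<in> neighborhood v. - 1) \<le> laplacian f v"
    unfolding laplacian_def
  proof (rule sum_mono)
    fix w assume "w \<in> neighborhood v"
    then show "- 1 \<le> f w - f v"
      using lipschitz[of w v] adj_sym by simp
  qed
  then show "- int d \<le> laplacian f v"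
    using assms(1) by (simp add: card_neighborhood_eq)
qed

lemma graph_dist_bound:
  assumes conn: "Digraph_Component.connected G"
    and drop: "\<And>f u v. \<lbrakk>u \<rightarrow> v; f v = f u + 1; \<And>x y. x \<rightarrow> y \<Longrightarrow> f y \<le> f x + 1\<rbrakk>
      \<Longrightarrow> c \<le> laplacian f u - laplacian f v"
    and s: "s \<in> verts G" and v: "v \<in> verts G"
  obtains k where "graph_dist s v = real k" "c * int k \<le> 2 * int d"
proof -
  have reach: "s \<rightarrow>\<^sup>* x" if "x \<in> verts G" for x
    using symmetric_connected_imp_strongly_connected[OF sym_arcs conn] s that by blast
  \<comment> \<open>Connectedness makes all distances finite, so that they can be turned into an
    integer-valued \<open>f\<close>.\<close>
  then have "\<forall>x\<in>verts G. \<exists>k. graph_dist s x = real k"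
    using graph_dist_walk by metis
  then obtain g where g: "\<And>x. x \<in> verts G \<Longrightarrow> graph_dist s x = real (g x)"
    by metis
  define f where "f x = int (g x)" for x
  have lipschitz: "f y \<le> f x + 1" if "x \<rightarrow> y" for x y
  proof -
    have "ereal (real (g y)) \<le> ereal (real (g x)) + 1"
      using graph_dist_adjacent[OF that, of s] g that by (auto dest: adj_in_verts)
    then show ?thesis
      by (simp add: f_def one_ereal_def)
  qed
  \<comment> \<open>The drops accumulated along a shortest path from \<open>s\<close>, by induction
    on its length.\<close>
  have "c * int k \<le> int d - laplacian f x" if "x \<in> verts G" "g x = k" for x k
    using that
  proof (induction k arbitrary: x)
    case 0
    then show ?case
      using laplacian_bounds(1)[of x f] lipschitz by simp
  next
    case (Suc k)
    have "x \<noteq> s"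
      using graph_dist_refl[OF s] g[OF s] Suc.prems by (auto simp: zero_ereal_def)
    then obtain u where u: "u \<rightarrow> x" "graph_dist s x = graph_dist s u + 1"
      using graph_dist_predecessor reach Suc.prems by metis
    have u_vert: "u \<in> verts G"
      using u(1) by (rule adj_in_verts)
    have step: "g u = k"
      using u(2) g[OF u_vert] g[OF Suc.prems(1)] Suc.prems(2) by (simp add: one_ereal_def)
    have "f x = f u + 1"
      using step Suc.prems by (simp add: f_def)
    then have "c \<le> laplacian f u - laplacian f x"
      using drop u(1) lipschitz by blast
    then show ?case
      using Suc.IH[OF u_vert step] by (simp add: algebra_simps)
  qed
  then have "c * int (g v) \<le> 2 * int d"
    using laplacian_bounds(2)[of v f] lipschitz v by fastforce
  then show ?thesis
    using that g v by blast
qed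

lemma diam_bound:
  assumes conn: "Digraph_Component.connected G"
    and drop: "\<And>f u v. \<lbrakk>u \<rightarrow> v; f v = f u + 1; \<And>x y. x \<rightarrow> y \<Longrightarrow> f y \<le> f x + 1\<rbrakk>
      \<Longrightarrow> c \<le> laplacian f u - laplacian f v"
    and bound: "\<And>k. c * int k \<le> 2 * int d \<Longrightarrow> real k \<le> b"
  shows "diam \<le> ereal b"
proof -
  let ?D = "{graph_dist u v | u v. u \<in> verts G \<and> v \<in> verts G}"
  have "?D = (\<lambda>(u, v). graph_dist u v) ` (verts G \<times> verts G)"
    by auto
  then have "finite ?D"
    by simp
  \<comment> \<open>Connectedness includes the existence of a vertex.\<close>
  moreover have "?D \<noteq> {}"
    using symmetric_connected_imp_strongly_connected[OF sym_arcs conn]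
    unfolding strongly_connected_def by blast
  moreover have "graph_dist u v \<le> ereal b" if "u \<in> verts G" "v \<in> verts G" for u v
    using graph_dist_bound[OF conn drop that] bound by (metis ereal_less_eq(3))
  ultimately show ?thesis
    unfolding diam_def by (subst Max_le_iff) auto
qed

end

theorem corollary1p4:
  fixes G :: "('a, 'b) pre_digraph" and n d \<alpha> \<beta> :: nat
  assumes "amply_regular_graph G n d \<alpha> \<beta>"
    and "Digraph_Component.connected G"
  shows "(\<beta> \<noteq> 1 \<and> \<beta> \<ge> \<alpha> \<longrightarrow> wf_digraph.diam G \<le> ereal (real d)) \<and>
    (\<beta> > \<alpha> \<and> \<alpha> \<ge> 1 \<longrightarrow>
      wf_digraph.diam G \<le> ereal (real_of_int \<lfloor>2 / 3 * real d\<rfloor>))"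
proof -
  interpret amply_regular_graph G n d \<alpha> \<beta>
    by fact
  show ?thesis
  proof (intro conjI impI; elim conjE)
    assume "\<beta> \<noteq> 1" "\<alpha> \<le> \<beta>"
    then show "diam \<le> ereal (real d)"
      by (intro diam_bound[OF assms(2), of 2] laplacian_drop_ge_2) auto
  next
    assume "\<alpha> < \<beta>" "1 \<le> \<alpha>"
    moreover have "real k \<le> real_of_int \<lfloor>2 / 3 * real d\<rfloor>" if "3 * int k \<le> 2 * int d" for k
    proof -
      \<comment> \<open>Rounding down is harmless since \<open>k\<close> is an integer.\<close>
      have "int k \<le> \<lfloor>2 / 3 * real d\<rfloor>"
        using that by (simp add: le_floor_iff)
      then show ?thesis
        by linarith
    qed
    ultimately show "diam \<le> ereal (real_of_int \<lfloor>2 / 3 * real d\<rfloor>)"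
      by (intro diam_bound[OF assms(2), of 3] laplacian_drop_ge_3) auto
  qed
qed

end
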